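(* Let $X$ be a Banach space, $p\in\mathbb{N}$, and let $T:X\rightrightarrows X^*$ be a linear operator. The following are equivalent: (1) $T$ is $p$-monotone; (2) $T^{\mu_p}(0)=\mathrm{dom}(T)^{\perp}$; (3) $T^{\mu_p}\neq\emptyset$; (4) $(0,0)\in T^{\mu_p}$.
   Context: $X$ is a real Banach space with topological dual $X^*$ and duality product $\langle x,x^*\rangle$. $\mathbb{N}=\{1,2,\dots\}$. A multivalued operator $T:X\rightrightarrows X^*$ assigns to each $x\in X$ a subset $T(x)\subset X^*$ (possibly empty); it is identified with its graph $\{(x,x^* ): x^*\in T(x)\}\subset X\times X^*$, so $(x,x^* )\in T$ means $x^*\in T(x)$. Its domain is $\mathrm{dom}(T)=\{x: T(x)\neq\emptyset\}$. $T$ is linear if its graph is a linear subspace of $X\times X^*$. For $A\subset X$, $A^\perp=\{x^*\in X^*: \langle x,x^*\rangle=0\ \forall x\in A\}$. $T$ is $p$-monotone if for every $(x_0,x_0^* ),\dots,(x_p,x_p^* )\in T$ (not necessarily distinct), with $x_{p+1}=x_0$, one has $\sum_{i=0}^p\langle x_{i+1}-x_i,x_i^*\rangle\le 0$. The $p$-monotone polar $T^{\mu_p}:X\rightrightarrows X^*$ is the operator whose graph is the set of all $(x_0,x_0^* )\in X\times X^*$ such that $\sum_{i=0}^p\langle x_{i+1}-x_i,x_i^*\rangle\le 0$ for all $(x_1,x_1^* ),\dots,(x_p,x_p^* )\in T$, where $x_{p+1}=x_0$. *)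

theory Defs
  imports "HOL-Analysis.Analysis"
begin

text \<open>
  A multivalued operator from \<open>X\<close> to its dual is represented by its graph. Thus \<open>T(x)\<close> is the
  relational image \<open>T `` {x}\<close>, \<open>dom(T)\<close> is \<^term>\<open>Domain T\<close>, and linearity of the operator is
  \<^term>\<open>subspace T\<close> in the product vector space.
\<close>

type_synonym 'a dual = "'a \<Rightarrow>\<^sub>L real"

type_synonym 'a operator = "('a \<times> 'a dual) set"

definition annihilator :: "'a::real_normed_vector set \<Rightarrow> 'a dual set"
  where "annihilator A = {x'. \<forall>x\<in>A. blinfun_apply x' x = 0}"

text \<open>
  The points are \<open>z i = (x\<^sub>i, x\<^sub>i\<^sup>*)\<close> for \<open>i = 0, \<dots>, p\<close>; the conditional encodes the convention
  \<open>x\<^sub>p\<^sub>+\<^sub>1 = x\<^sub>0\<close>. Values of \<open>z\<close> beyond \<open>p\<close> are irrelevant.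
\<close>

definition cyclic_sum :: "nat \<Rightarrow> (nat \<Rightarrow> 'a::real_normed_vector \<times> 'a dual) \<Rightarrow> real"
  where "cyclic_sum p z =
    (\<Sum>i=0..p. blinfun_apply (snd (z i)) (fst (z (if i = p then 0 else i + 1)) - fst (z i)))"

definition p_monotone :: "nat \<Rightarrow> 'a::real_normed_vector operator \<Rightarrow> bool"
  where "p_monotone p T \<longleftrightarrow> (\<forall>z. (\<forall>i\<in>{0..p}. z i \<in> T) \<longrightarrow> cyclic_sum p z \<le> 0)"

definition p_polar :: "nat \<Rightarrow> 'a::real_normed_vector operator \<Rightarrow> 'a operator"
  where "p_polar p T =
    {w. \<forall>z. z 0 = w \<and> (\<forall>i\<in>{1..p}. z i \<in> T) \<longrightarrow> cyclic_sum p z \<le> 0}"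

end

theory Submission
  imports Defs
begin

text \<open>
  The cyclic sum is quadratic in its points and invariant under translating all of them by a
  common vector of \<open>X \<times> X\<^sup>*\<close> (lemma \<open>cyclic_sum_translate\<close>). Write \<open>S(z)\<close> for its value when
  \<open>x\<^sub>0 = 0\<close>, \<open>x\<^sub>0\<^sup>* = 0\<close>. Since the graph of \<open>T\<close> is a subspace, a \<open>(p+1)\<close>-tuple in \<open>T\<close> can be
  translated so that its first point becomes \<open>(0,0)\<close> without leaving \<open>T\<close>; hence
  \<open>p\<close>-monotonicity says exactly that \<open>S \<le> 0\<close> on \<open>T\<close>, that is, \<open>(0,0) \<in> T\<^sup>\<mu>\<^sup>p\<close>
  (lemma \<open>p_monotone_iff_zero_in_p_polar\<close>).

  The other two equivalences come from scaling. If \<open>(x\<^sub>0,x\<^sub>0\<^sup>*)\<close> is in the polar, then replacing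
  the remaining points \<open>z\<^sub>i\<close> by \<open>t z\<^sub>i\<close> gives, for every real \<open>t\<close>,
  \[ -\langle x_0,x_0^*\rangle
     + t(\langle x_1,x_0^*\rangle + \langle x_0,x_p^*\rangle) + t^2 S(z) \le 0 \]
  (lemma \<open>p_polar_quadratic\<close>). Letting \<open>t\<close> grow yields \<open>S(z) \<le> 0\<close>, so a nonempty polar contains
  \<open>(0,0)\<close>. If \<open>x\<^sub>0 = 0\<close> the constant term vanishes, and small \<open>t\<close> of both signs force the linear
  coefficient \<open>\<langle>x\<^sub>1,x\<^sub>0\<^sup>*\<rangle>\<close> to be \<open>0\<close>, so that \<open>x\<^sub>0\<^sup>*\<close> annihilates the domain. Conversely a
  functional annihilating the domain does not change the sum, so it lies in \<open>T\<^sup>\<mu>\<^sup>p(0)\<close> as soon as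
  \<open>S \<le> 0\<close>.
\<close>

lemma quadratic_nonpos_imp_leading_nonpos:
  fixes a b c :: real
  assumes "\<And>t. a + t * b + t\<^sup>2 * c \<le> 0"
  shows "c \<le> 0"
proof (rule ccontr)
  assume "\<not> c \<le> 0"
  then have c: "c > 0" by simp
  define t where "t = \<bar>a\<bar> / c + 1"
  have t: "t \<ge> 1" using c by (simp add: t_def)
  \<comment> \<open>Averaging the values at \<open>t\<close> and \<open>-t\<close> removes the linear term.\<close>
  have "a + t\<^sup>2 * c \<le> 0"
    using assms[of t] assms[of "-t"] by simp
  moreover have "t * c \<le> t\<^sup>2 * c"
    using t c by (simp add: power2_eq_square)
  moreover have "t * c = \<bar>a\<bar> + c"
    using c by (simp add: t_def field_simps)
  ultimately show False using c by linarith
qed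

lemma quadratic_nonpos_imp_linear_zero:
  fixes b c :: real
  assumes "\<And>t. t * b + t\<^sup>2 * c \<le> 0"
  shows "b = 0"
proof (rule ccontr)
  assume b: "b \<noteq> 0"
  define s where "s = 1 / (\<bar>c\<bar> + 1)"
  have s: "s > 0" "s * (\<bar>c\<bar> + 1) = 1" by (simp_all add: s_def add_nonneg_eq_0_iff)
  \<comment> \<open>The sign of \<open>t = s * b\<close> makes the linear term positive; its size makes that term dominate.\<close>
  have "(s * b\<^sup>2) * (1 + s * c) \<le> 0"
    using assms[of "s * b"] by (simp add: power2_eq_square algebra_simps)
  moreover have "1 + s * c > 0"
  proof -
    have "s * (\<bar>c\<bar> + 1 + c) > 0" using s(1) by (intro mult_pos_pos) auto
    then show ?thesis using s(2) by (simp add: algebra_simps)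
  qed
  ultimately show False
    using s(1) b by (simp add: mult_le_0_iff)
qed

lemma cyclic_sum_scaleR: "cyclic_sum p (\<lambda>i. t *\<^sub>R z i) = t\<^sup>2 * cyclic_sum p z"
  unfolding cyclic_sum_def sum_distrib_left
  by (intro sum.cong)
     (auto simp: blinfun.scaleR_left blinfun.scaleR_right blinfun.diff_right
        power2_eq_square algebra_simps)

lemma cyclic_differences_sum_zero:
  fixes x :: "nat \<Rightarrow> 'b::ab_group_add"
  shows "(\<Sum>i=0..p. x (if i = p then 0 else i + 1) - x i) = 0"
proof -
  have "(\<Sum>i=0..p. x (if i = p then 0 else i + 1) - x i)
      = (\<Sum>i<p. x (Suc i) - x i) + (x 0 - x p)"
    by (simp add: atLeast0AtMost lessThan_Suc_atMost[symmetric] del: sum_subtractf)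
  then show ?thesis by (simp only: sum_lessThan_telescope) simp
qed

text \<open>
  The increments of the points are unaffected by a translation, and because they add up to zero
  around the cycle, subtracting one fixed functional from all \<open>x\<^sub>i\<^sup>*\<close> changes nothing either.
\<close>

lemma cyclic_sum_translate: "cyclic_sum p (\<lambda>i. z i - w) = cyclic_sum p z"
proof -
  have "cyclic_sum p (\<lambda>i. z i - w)
      = cyclic_sum p z
        - (\<Sum>i=0..p. blinfun_apply (snd w) (fst (z (if i = p then 0 else i + 1)) - fst (z i)))"
    unfolding cyclic_sum_def sum_subtractf[symmetric]
    by (intro sum.cong) (simp_all add: blinfun.diff_left)
  also have "(\<Sum>i=0..p. blinfun_apply (snd w) (fst (z (if i = p then 0 else i + 1)) - fst (z i)))
      = blinfun_apply (snd w) (\<Sum>i=0..p. fst (z (if i = p then 0 else i + 1)) - fst (z i))"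
    by (simp only: blinfun.sum_right)
  also have "\<dots> = 0"
    by (simp only: cyclic_differences_sum_zero[of "\<lambda>i. fst (z i)"] blinfun.zero_right)
  finally show ?thesis by simp
qed

text \<open>
  Only the two edges of the cycle that meet the initial point see it, which isolates the
  dependence of the sum on that point.
\<close>

lemma cyclic_sum_initial_point:
  assumes "p \<ge> 1"
  shows "cyclic_sum p (z(0 := w)) =
    blinfun_apply (snd w) (fst (z 1) - fst w) + blinfun_apply (snd (z p)) (fst w)
      + cyclic_sum p (z(0 := 0))"
proof -
  have "cyclic_sum p (z(0 := w)) =
      (\<Sum>i=0..p. (if i = 0 then blinfun_apply (snd w) (fst (z 1) - fst w) else 0)
        + (if i = p then blinfun_apply (snd (z p)) (fst w) else 0)
        + blinfun_apply (snd ((z(0 := 0)) i))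
            (fst ((z(0 := 0)) (if i = p then 0 else i + 1)) - fst ((z(0 := 0)) i)))"
    unfolding cyclic_sum_def using assms
    by (intro sum.cong) (auto simp: blinfun.diff_right blinfun.minus_right)
  then show ?thesis
    by (simp add: cyclic_sum_def sum.distrib)
qed

lemma in_p_polar_iff:
  "w \<in> p_polar p T \<longleftrightarrow> (\<forall>z. (\<forall>i\<in>{1..p}. z i \<in> T) \<longrightarrow> cyclic_sum p (z(0 := w)) \<le> 0)"
proof
  assume w: "w \<in> p_polar p T"
  show "\<forall>z. (\<forall>i\<in>{1..p}. z i \<in> T) \<longrightarrow> cyclic_sum p (z(0 := w)) \<le> 0"
    using w by (auto simp: p_polar_def)
next
  assume R: "\<forall>z. (\<forall>i\<in>{1..p}. z i \<in> T) \<longrightarrow> cyclic_sum p (z(0 := w)) \<le> 0"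
  show "w \<in> p_polar p T"
    unfolding p_polar_def
  proof (intro CollectI allI impI)
    fix z assume z: "z 0 = w \<and> (\<forall>i\<in>{1..p}. z i \<in> T)"
    then have "z(0 := w) = z" by auto
    then show "cyclic_sum p z \<le> 0" using R z by metis
  qed
qed

text \<open>
  Membership in the polar is tested on the whole line of tuples \<open>t z\<close>, all of which stay in \<open>T\<close>.
  The initial point is the only one that is not scaled, so the terms of the sum sort by degree
  in \<open>t\<close>.
\<close>

lemma p_polar_quadratic:
  assumes "p \<ge> 1" "subspace T" "w \<in> p_polar p T" "\<forall>i\<in>{1..p}. z i \<in> T"
  shows "- blinfun_apply (snd w) (fst w)
    + t * (blinfun_apply (snd w) (fst (z 1)) + blinfun_apply (snd (z p)) (fst w))
    + t\<^sup>2 * cyclic_sum p (z(0 := 0)) \<le> 0"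
proof -
  let ?y = "\<lambda>i. t *\<^sub>R z i"
  have "\<forall>i\<in>{1..p}. ?y i \<in> T"
    using assms(2,4) by (simp add: subspace_scale)
  then have "cyclic_sum p (?y(0 := w)) \<le> 0"
    by (rule in_p_polar_iff[THEN iffD1, OF assms(3), THEN spec, THEN mp])
  moreover have "?y(0 := 0) = (\<lambda>i. t *\<^sub>R (z(0 := 0)) i)"
    by auto
  then have "cyclic_sum p (?y(0 := 0)) = t\<^sup>2 * cyclic_sum p (z(0 := 0))"
    by (simp only: cyclic_sum_scaleR)
  ultimately show ?thesis
    unfolding cyclic_sum_initial_point[OF assms(1), of ?y w]
    by (simp add: blinfun.scaleR_left blinfun.scaleR_right blinfun.diff_right algebra_simps)
qed

lemma p_polar_nonempty_iff_zero_in: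
  assumes "p \<ge> 1" "subspace T"
  shows "p_polar p T \<noteq> {} \<longleftrightarrow> 0 \<in> p_polar p T"
proof
  assume "p_polar p T \<noteq> {}"
  then obtain w where w: "w \<in> p_polar p T" by blast
  show "0 \<in> p_polar p T"
    unfolding in_p_polar_iff
  proof (intro allI impI)
    fix z assume "\<forall>i\<in>{1..p}. z i \<in> T"
    from quadratic_nonpos_imp_leading_nonpos[OF p_polar_quadratic[OF assms w this]]
    show "cyclic_sum p (z(0 := 0)) \<le> 0" .
  qed
qed blast

lemma p_monotone_iff_zero_in_p_polar:
  assumes "subspace T"
  shows "p_monotone p T \<longleftrightarrow> 0 \<in> p_polar p T"
proof
  assume mono: "p_monotone p T"
  show "0 \<in> p_polar p T"
    unfolding in_p_polar_iff
  proof (intro allI impI)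
    fix z assume "\<forall>i\<in>{1..p}. z i \<in> T"
    then have "\<forall>i\<in>{0..p}. (z(0 := 0)) i \<in> T"
      using subspace_0[OF assms] by auto
    then show "cyclic_sum p (z(0 := 0)) \<le> 0"
      using mono unfolding p_monotone_def by blast
  qed
next
  assume zero: "0 \<in> p_polar p T"
  show "p_monotone p T"
    unfolding p_monotone_def
  proof (intro allI impI)
    fix z assume z: "\<forall>i\<in>{0..p}. z i \<in> T"
    let ?u = "\<lambda>i. z i - z 0"
    have "\<forall>i\<in>{1..p}. ?u i \<in> T"
      using z by (auto intro!: subspace_diff[OF assms])
    then have "cyclic_sum p (?u(0 := 0)) \<le> 0"
      by (rule in_p_polar_iff[THEN iffD1, OF zero, THEN spec, THEN mp])
    moreover have "?u(0 := 0) = ?u" by auto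
    ultimately show "cyclic_sum p z \<le> 0"
      by (simp only: cyclic_sum_translate)
  qed
qed

text \<open>
  At the base point \<open>0\<close> the constant term of the quadratic polynomial in \<open>t\<close> vanishes, so its
  linear coefficient must vanish as well.
\<close>

lemma p_polar_at_zero_subset_annihilator:
  assumes "p \<ge> 1" "subspace T"
  shows "p_polar p T `` {0} \<subseteq> annihilator (Domain T)"
proof
  fix x' assume "x' \<in> p_polar p T `` {0}"
  then have w: "(0, x') \<in> p_polar p T" by simp
  have "blinfun_apply x' x = 0" if "(x, y) \<in> T" for x y
  proof -
    \<comment> \<open>Only the point after the base point enters the linear term, so a constant tuple suffices.\<close>
    let ?z = "\<lambda>_::nat. (x, y)"
    have "t * blinfun_apply x' x + t\<^sup>2 * cyclic_sum p (?z(0 := 0)) \<le> 0" for t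
      using p_polar_quadratic[OF assms w, of ?z t] that by simp
    then show ?thesis by (rule quadratic_nonpos_imp_linear_zero)
  qed
  then show "x' \<in> annihilator (Domain T)"
    by (auto simp: annihilator_def)
qed

lemma annihilator_subset_p_polar_at_zero:
  assumes "p \<ge> 1" "0 \<in> p_polar p T"
  shows "annihilator (Domain T) \<subseteq> p_polar p T `` {0}"
proof
  fix x' assume x': "x' \<in> annihilator (Domain T)"
  have "(0, x') \<in> p_polar p T"
    unfolding in_p_polar_iff
  proof (intro allI impI)
    fix z assume z: "\<forall>i\<in>{1..p}. z i \<in> T"
    then have "z 1 \<in> T" using assms(1) by simp
    then have "blinfun_apply x' (fst (z 1)) = 0"
      using x' by (auto simp: annihilator_def Domain_fst)
    moreover have "cyclic_sum p (z(0 := 0)) \<le> 0"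
      using assms(2) z unfolding in_p_polar_iff by blast
    ultimately show "cyclic_sum p (z(0 := (0, x'))) \<le> 0"
      unfolding cyclic_sum_initial_point[OF assms(1), of z "(0, x')"] by simp
  qed
  then show "x' \<in> p_polar p T `` {0}" by simp
qed

theorem theorem3p3:
  fixes T :: "'a::banach operator" and p :: nat
  assumes "p \<ge> 1"
    and "subspace T"
  shows "(p_monotone p T \<longleftrightarrow> p_polar p T `` {0} = annihilator (Domain T)) \<and>
         (p_monotone p T \<longleftrightarrow> p_polar p T \<noteq> {}) \<and>
         (p_monotone p T \<longleftrightarrow> (0, 0) \<in> p_polar p T)"
proof -
  have zero: "p_monotone p T \<longleftrightarrow> (0, 0) \<in> p_polar p T"
    using p_monotone_iff_zero_in_p_polar[OF assms(2)] by (simp add: zero_prod_def)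
  have nonempty: "p_monotone p T \<longleftrightarrow> p_polar p T \<noteq> {}"
    using p_monotone_iff_zero_in_p_polar[OF assms(2)] p_polar_nonempty_iff_zero_in[OF assms]
    by blast
  have "p_monotone p T \<longleftrightarrow> p_polar p T `` {0} = annihilator (Domain T)"
  proof
    assume "p_monotone p T"
    then have "0 \<in> p_polar p T"
      using p_monotone_iff_zero_in_p_polar[OF assms(2)] by blast
    then show "p_polar p T `` {0} = annihilator (Domain T)"
      using p_polar_at_zero_subset_annihilator[OF assms]
        annihilator_subset_p_polar_at_zero[OF assms(1)] by blast
  next
    assume eq: "p_polar p T `` {0} = annihilator (Domain T)"
    \<comment> \<open>The zero functional annihilates everything.\<close>
    have "0 \<in> annihilator (Domain T)" by (simp add: annihilator_def)
    then have "(0, 0) \<in> p_polar p T" using eq by blast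
    then show "p_monotone p T" using zero by blast
  qed
  then show ?thesis using nonempty zero by blast
qed

end
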